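(* Let $f:\mathbb R^N\to\mathbb R$ be a $\mathcal C^2$ function whose gradient is Lipschitz continuous on the bounded sets, and such that $\inf_{\mathbb R^N}f>-\infty$. Let $\phi:\mathbb R^N\to\mathbb R_+$ be a damping potential which is differentiable. Let $h>0$ and let $(x_n)_{n\in\mathbb N}$ be a bounded sequence generated by the algorithm $$x_{n+2}=x_{n+1}+h\,\mathrm{prox}_{h\phi}\Big(\frac1h(x_{n+1}-x_n)-h\nabla f(x_{n+1})\Big).$$ Assume the following: (assumption on $f$) the function $H:\mathbb R^N\times\mathbb R^N\to\mathbb R$, $H(x,y):=f(x)+\frac1{2h^2}\|x-y\|^2$, satisfies the (KL) property; (assumption on $\phi$) there exist positive $\gamma,\varepsilon,\delta$ such that $\phi(u)\ge\gamma\|u\|^2$ for all $u\in\mathbb R^N$, and $\|\nabla\phi(u)\|\le\delta\|u\|$ for all $u$ with $\|u\|\le\varepsilon$; (assumption on $h$) $0<h<\frac{2\gamma}{L}$, where $L$ is the Lipschitz constant of $\nabla f$ on the ball centered at the origin with radius $R=\sup_{n\in\mathbb N}\|x_n\|$. Then: (i) $x_n\to x_\infty$ as $n\to+\infty$, where $\nabla f(x_\infty)=0$; (ii) $\sum_{n\in\mathbb N}\|x_{n+1}-x_n\|<+\infty$.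
   Context: $\mathbb R^N$ carries its Euclidean structure. A function $\phi:\mathbb R^N\to\mathbb R_+$ is a damping potential if it is nonnegative, convex and continuous, with $\phi(0)=0=\min\phi$ (and the minimal-norm element of $\partial\phi(u)$ is bounded on bounded sets, which is automatic in finite dimension). For $\lambda>0$, $\mathrm{prox}_{\lambda\phi}(x):=\operatorname{argmin}_{\xi\in\mathbb R^N}\{\lambda\phi(\xi)+\frac12\|x-\xi\|^2\}$. (KL) property: a differentiable function $G:\mathbb R^m\to\mathbb R$ satisfies the (KL) property if for each critical point $\bar z$ of $G$ there exist $\eta>0$, a neighborhood $U$ of $\bar z$ and a continuous concave increasing function $\theta:[0,\eta)\to[0,+\infty)$ with $\theta(0)=0$, $\theta\in\mathcal C^1(0,\eta)$ and $\theta'>0$ on $(0,\eta)$, such that $\theta'(G(z)-G(\bar z))\,\|\nabla G(z)\|\ge1$ for all $z\in U$ with $G(\bar z)<G(z)<G(\bar z)+\eta$. If $L=0$, the condition $h<2\gamma/L$ is understood as no upper restriction on $h$. *)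

theory Defs
  imports "HOL-Analysis.Analysis"
begin

definition grad :: "('a::real_inner \<Rightarrow> real) \<Rightarrow> 'a \<Rightarrow> 'a" where
  "grad f x = (THE D. GDERIV f x :> D)"

definition C1_map :: "('a::real_normed_vector \<Rightarrow> 'b::real_normed_vector) \<Rightarrow> bool" where
  "C1_map g \<longleftrightarrow>
     (\<exists>g' :: 'a \<Rightarrow> 'a \<Rightarrow>\<^sub>L 'b.
        (\<forall>x. (g has_derivative blinfun_apply (g' x)) (at x)) \<and> continuous_on UNIV g')"

definition C2_map :: "('a::real_normed_vector \<Rightarrow> 'b::real_normed_vector) \<Rightarrow> bool" where
  "C2_map g \<longleftrightarrow>
     (\<exists>g' :: 'a \<Rightarrow> 'a \<Rightarrow>\<^sub>L 'b.
        (\<forall>x. (g has_derivative blinfun_apply (g' x)) (at x)) \<and> C1_map g')"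

definition lipschitz_on_bounded_sets ::
    "('a::metric_space \<Rightarrow> 'b::metric_space) \<Rightarrow> bool" where
  "lipschitz_on_bounded_sets g \<longleftrightarrow> (\<forall>B. bounded B \<longrightarrow> (\<exists>L. L-lipschitz_on B g))"

text \<open>The best Lipschitz constant; meaningful only if \<open>g\<close> is Lipschitz on \<open>S\<close>.\<close>

definition lipschitz_constant :: "('a::metric_space \<Rightarrow> 'b::metric_space) \<Rightarrow> 'a set \<Rightarrow> real" where
  "lipschitz_constant g S = Inf {L. L-lipschitz_on S g}"

definition subdifferential :: "('a::real_inner \<Rightarrow> real) \<Rightarrow> 'a \<Rightarrow> 'a set" where
  "subdifferential \<phi> u = {p. \<forall>v. \<phi> v \<ge> \<phi> u + p \<bullet> (v - u)}"

text \<open>\<open>closest_point (subdifferential \<phi> u) 0\<close> is the minimal-norm element of the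
  subdifferential, which is nonempty, closed and convex for convex continuous \<open>\<phi>\<close>. The last
  conjunct is automatic in finite dimension.\<close>

definition damping_potential :: "('a::euclidean_space \<Rightarrow> real) \<Rightarrow> bool" where
  "damping_potential \<phi> \<longleftrightarrow>
     (\<forall>u. \<phi> u \<ge> 0) \<and> convex_on UNIV \<phi> \<and> continuous_on UNIV \<phi> \<and> \<phi> 0 = 0 \<and>
     (\<forall>B. bounded B \<longrightarrow> bounded ((\<lambda>u. closest_point (subdifferential \<phi> u) 0) ` B))"

definition prox :: "('a::real_inner \<Rightarrow> real) \<Rightarrow> 'a \<Rightarrow> 'a" where
  "prox \<psi> x = arg_min (\<lambda>\<xi>. \<psi> \<xi> + 1 / 2 * (norm (x - \<xi>))\<^sup>2) (\<lambda>_. True)"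

definition KL_property :: "('b::euclidean_space \<Rightarrow> real) \<Rightarrow> bool" where
  "KL_property G \<longleftrightarrow>
     (\<forall>z. G differentiable (at z)) \<and>
     (\<forall>zbar. grad G zbar = 0 \<longrightarrow>
       (\<exists>\<eta>>0. \<exists>U. zbar \<in> interior U \<and>
         (\<exists>\<theta> :: real \<Rightarrow> real.
            \<theta> ` {0..<\<eta>} \<subseteq> {0..} \<and> continuous_on {0..<\<eta>} \<theta> \<and> concave_on {0..<\<eta>} \<theta> \<and>
            strict_mono_on {0..<\<eta>} \<theta> \<and> \<theta> 0 = 0 \<and>
            \<theta> C1_differentiable_on {0<..<\<eta>} \<and> (\<forall>s\<in>{0<..<\<eta>}. deriv \<theta> s > 0) \<and>
            (\<forall>z\<in>U. G zbar < G z \<and> G z < G zbar + \<eta> \<longrightarrow>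
               deriv \<theta> (G z - G zbar) * norm (grad G z) \<ge> 1))))"

end

theory Submission
  imports Defs
begin

text \<open>
  The recursion discretises Newton's equation in the potential \<open>f\<close> with damping force \<open>- \<nabla>\<phi>\<close>. In terms of the velocity
  \<open>v\<^sub>n = (x\<^sub>n\<^sub>+\<^sub>1 - x\<^sub>n) / h\<close>, Fermat's rule for the proximal step reads
  \<open>v\<^sub>n\<^sub>+\<^sub>1 - v\<^sub>n + h \<nabla>\<phi>(v\<^sub>n\<^sub>+\<^sub>1) + h \<nabla>f(x\<^sub>n\<^sub>+\<^sub>1) = 0\<close> (\<open>prox_optimality\<close>).
  The function \<open>H\<close> evaluated at \<open>z\<^sub>n = (x\<^sub>n\<^sub>+\<^sub>1, x\<^sub>n)\<close> is the mechanical energy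
  \<open>f(x\<^sub>n\<^sub>+\<^sub>1) + \<parallel>v\<^sub>n\<parallel>\<^sup>2 / 2\<close>. Pairing Fermat's rule with \<open>v\<^sub>n\<^sub>+\<^sub>1\<close> shows that the energy is
  dissipated: convexity of \<open>\<phi>\<close> gives \<open>\<langle>\<nabla>\<phi>(v), v\<rangle> \<ge> \<phi>(v) \<ge> \<gamma> \<parallel>v\<parallel>\<^sup>2\<close>, while \<open>descent_lemma\<close> bounds what
  the explicit treatment of \<open>\<nabla>f\<close> can give back, by \<open>L h\<^sup>2 \<parallel>v\<parallel>\<^sup>2 / 2\<close>. The condition \<open>h < 2 \<gamma> / L\<close> says
  exactly that the dissipation wins, so \<open>H(z\<^sub>n) - H(z\<^sub>n\<^sub>+\<^sub>1) \<ge> c \<parallel>v\<^sub>n\<^sub>+\<^sub>1\<parallel>\<^sup>2\<close> with \<open>c > 0\<close>.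

  As \<open>f\<close> is bounded below, the velocities tend to zero. They eventually enter the ball on which
  \<open>\<nabla>\<phi>\<close> grows at most linearly, and there Fermat's rule turns into a bound on the slope:
  \<open>\<parallel>\<nabla>H(z\<^sub>n)\<parallel> \<le> C (\<parallel>v\<^sub>n\<parallel> + \<parallel>v\<^sub>n\<^sub>+\<^sub>1\<parallel>)\<close>. Every cluster point of \<open>z\<^sub>n\<close> is then of the form \<open>(l, l)\<close> with
  \<open>\<nabla>f(l) = 0\<close>, hence critical for \<open>H\<close>.

  Sufficient decrease, the slope bound and a critical cluster point are all that the
  Kurdyka--Lojasiewicz argument \<open>KL_descent_summable\<close> uses to conclude that the lengths of the steps
  are summable. The sequence \<open>x\<close> is therefore Cauchy, and its limit is critical because
  \<open>\<nabla>f(x\<^sub>n)\<close> tends to zero.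
\<close>

section \<open>Gradients\<close>

lemma GDERIV_uniqueness:
  assumes "GDERIV f x :> D" "GDERIV f x :> D'"
  shows "D = D'"
proof -
  have "(\<lambda>h. h \<bullet> D) = (\<lambda>h. h \<bullet> D')"
    using assms unfolding gderiv_def by (rule has_derivative_unique)
  then have "(D - D') \<bullet> D = (D - D') \<bullet> D'"
    by (rule fun_cong)
  then have "(D - D') \<bullet> (D - D') = 0"
    by (simp add: inner_diff_right)
  then show ?thesis by simp
qed

lemma grad_eqI:
  assumes "GDERIV f x :> D"
  shows "grad f x = D"
  unfolding grad_def
  by (rule the_equality) (use assms GDERIV_uniqueness in blast)+

lemma differentiable_imp_GDERIV_grad:
  fixes f :: "'a::euclidean_space \<Rightarrow> real"
  assumes "f differentiable (at x)"
  shows "GDERIV f x :> grad f x"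
proof -
  obtain f' where f': "(f has_derivative f') (at x)"
    using assms unfolding differentiable_def by blast
  interpret linear f' using f' by (rule has_derivative_linear)
  define D where "D = (\<Sum>b\<in>Basis. f' b *\<^sub>R b)"
  have "f' v = v \<bullet> D" for v
  proof -
    have "f' v = f' (\<Sum>b\<in>Basis. (v \<bullet> b) *\<^sub>R b)" by (simp add: euclidean_representation)
    also have "\<dots> = v \<bullet> D"
      by (simp add: D_def sum scale inner_sum_right mult.commute)
    finally show ?thesis .
  qed
  then have "f' = (\<lambda>v. v \<bullet> D)" by blast
  then have "GDERIV f x :> D" using f' by (simp add: gderiv_def)
  then show ?thesis using grad_eqI by metis
qed

lemma GDERIV_along_line:
  assumes "GDERIV f (a + t *\<^sub>R d) :> D"
  shows "((\<lambda>t. f (a + t *\<^sub>R d)) has_real_derivative (d \<bullet> D)) (at t within T)"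
proof -
  have "((\<lambda>t. a + t *\<^sub>R d) has_derivative (\<lambda>s. s *\<^sub>R d)) (at t within T)"
    by (auto intro!: derivative_eq_intros)
  from has_derivative_compose[OF this assms[unfolded gderiv_def]]
  show ?thesis
    by (simp add: has_field_derivative_def mult.commute[of _ "d \<bullet> D"])
qed

text \<open>The restriction of \<open>\<phi>\<close> to the line through \<open>u\<close> and \<open>v\<close> reduces this to the tangent
  inequality for convex functions of one real variable.\<close>

lemma convex_gradient_inequality:
  assumes conv: "convex_on UNIV \<phi>" and D: "GDERIV \<phi> u :> D"
  shows "\<phi> v \<ge> \<phi> u + D \<bullet> (v - u)"
proof -
  define g where "g = (\<lambda>t::real. \<phi> (u + t *\<^sub>R (v - u)))"
  have "convex_on UNIV g"
  proof (rule convex_onI)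
    fix t a b :: real assume t: "0 < t" "t < 1"
    have eq: "u + ((1 - t) *\<^sub>R a + t *\<^sub>R b) *\<^sub>R (v - u)
        = (1 - t) *\<^sub>R (u + a *\<^sub>R (v - u)) + t *\<^sub>R (u + b *\<^sub>R (v - u))"
      by (simp add: algebra_simps)
    show "g ((1 - t) *\<^sub>R a + t *\<^sub>R b) \<le> (1 - t) * g a + t * g b"
      unfolding g_def eq using t by (intro convex_onD[OF conv]) auto
  qed simp
  moreover have "(g has_real_derivative ((v - u) \<bullet> D)) (at 0)"
    unfolding g_def by (rule GDERIV_along_line) (simp add: D)
  ultimately have "g 1 - g 0 \<ge> ((v - u) \<bullet> D) * (1 - 0)"
    by (intro convex_on_imp_above_tangent[of UNIV]) auto
  then show ?thesis by (simp add: g_def inner_commute)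
qed

text \<open>Along the segment from \<open>a\<close> to \<open>b\<close> the slope of \<open>f\<close> exceeds its initial value by at most
  \<open>M t \<parallel>b - a\<parallel>\<^sup>2\<close> at time \<open>t\<close>. Subtracting the antiderivative of this bound from \<open>f\<close> leaves a
  nonincreasing function of \<open>t\<close>. The segment stays in \<open>S\<close> by convexity, so a Lipschitz bound on
  \<open>S\<close> alone is enough.\<close>

lemma descent_lemma:
  assumes f: "\<And>z. z \<in> S \<Longrightarrow> GDERIV f z :> grad f z"
    and lip: "M-lipschitz_on S (grad f)" and S: "convex S" "a \<in> S" "b \<in> S"
  shows "f b \<le> f a + grad f a \<bullet> (b - a) + M / 2 * (norm (b - a))\<^sup>2"
proof -
  define d where "d = b - a"
  define g where "g = (\<lambda>t. f (a + t *\<^sub>R d) - t * (d \<bullet> grad f a) - M / 2 * (norm d)\<^sup>2 * t\<^sup>2)"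
  have "g 1 \<le> g 0"
  proof (rule DERIV_nonpos_imp_nonincreasing, simp)
    fix t :: real assume t: "0 \<le> t" "t \<le> 1"
    have eq: "a + t *\<^sub>R d = (1 - t) *\<^sub>R a + t *\<^sub>R b" by (simp add: d_def algebra_simps)
    have S': "a + t *\<^sub>R d \<in> S"
      unfolding eq using t S by (intro convexD) auto
    let ?y = "d \<bullet> grad f (a + t *\<^sub>R d) - d \<bullet> grad f a - M * (norm d)\<^sup>2 * t"
    have "(g has_real_derivative ?y) (at t)"
      unfolding g_def
      by (rule derivative_eq_intros GDERIV_along_line f S' refl | simp)+
    moreover have "?y \<le> 0"
    proof -
      have "d \<bullet> grad f (a + t *\<^sub>R d) - d \<bullet> grad f a
          \<le> norm d * norm (grad f (a + t *\<^sub>R d) - grad f a)"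
        by (metis inner_diff_right norm_cauchy_schwarz)
      also have "\<dots> \<le> norm d * (M * norm (t *\<^sub>R d))"
        using lipschitz_onD[OF lip S' S(2)] by (intro mult_left_mono) (auto simp: dist_norm)
      also have "\<dots> = M * (norm d)\<^sup>2 * t" using t by (simp add: power2_eq_square)
      finally show ?thesis by simp
    qed
    ultimately show "\<exists>y. (g has_real_derivative y) (at t) \<and> y \<le> 0" by blast
  qed
  then show ?thesis by (simp add: g_def d_def inner_commute)
qed

text \<open>The infimum that defines the best Lipschitz constant is attained: for each pair of distinct
  points the difference quotient is a lower bound of the set of Lipschitz constants.\<close>

lemma lipschitz_constant_lipschitz_on:
  assumes "\<exists>M. M-lipschitz_on S g"
  shows "(lipschitz_constant g S)-lipschitz_on S g"
proof (rule lipschitz_onI)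
  let ?A = "{M. M-lipschitz_on S g}"
  have ne: "?A \<noteq> {}" using assms by simp
  show "0 \<le> lipschitz_constant g S"
    unfolding lipschitz_constant_def by (rule cInf_greatest[OF ne]) (auto dest: lipschitz_on_nonneg)
  fix u v assume uv: "u \<in> S" "v \<in> S"
  show "dist (g u) (g v) \<le> lipschitz_constant g S * dist u v"
  proof (cases "u = v")
    case False
    then have pos: "dist u v > 0" by simp
    have "dist (g u) (g v) / dist u v \<le> lipschitz_constant g S"
      unfolding lipschitz_constant_def
    proof (rule cInf_greatest[OF ne])
      fix M assume "M \<in> ?A"
      then show "dist (g u) (g v) / dist u v \<le> M"
        using pos uv by (simp add: pos_divide_le_eq lipschitz_onD)
    qed
    then show ?thesis using pos by (simp add: pos_divide_le_eq)
  qed simp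
qed

lemma lipschitz_on_bounded_sets_isCont:
  fixes g :: "'a::real_normed_vector \<Rightarrow> 'b::metric_space"
  assumes "lipschitz_on_bounded_sets g"
  shows "isCont g y"
proof -
  obtain M where "M-lipschitz_on (ball y 1) g"
    using assms bounded_ball unfolding lipschitz_on_bounded_sets_def by blast
  then have "continuous_on (ball y 1) g" by (rule lipschitz_on_continuous_on)
  then show ?thesis by (simp add: continuous_on_eq_continuous_at)
qed

section \<open>The proximal map\<close>

text \<open>The proximal map is given by a choice operator, so its minimality has to come from the
  existence of some minimiser. As \<open>\<psi> \<ge> 0\<close>, the quadratic term makes the objective coercive, and
  continuity on a compact ball is enough.\<close>

lemma prox_minimizes:
  fixes \<psi> :: "'a::euclidean_space \<Rightarrow> real"
  assumes nonneg: "\<And>u. \<psi> u \<ge> 0" and cont: "continuous_on UNIV \<psi>"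
  shows "\<psi> (prox \<psi> w) + 1 / 2 * (norm (w - prox \<psi> w))\<^sup>2 \<le> \<psi> \<xi> + 1 / 2 * (norm (w - \<xi>))\<^sup>2"
proof -
  define F where "F = (\<lambda>\<xi>. \<psi> \<xi> + 1 / 2 * (norm (w - \<xi>))\<^sup>2)"
  define \<rho> where "\<rho> = sqrt (2 * \<psi> w)"
  have \<rho>: "\<rho> \<ge> 0" "\<rho>\<^sup>2 = 2 * \<psi> w" using nonneg[of w] by (auto simp: \<rho>_def)
  have "continuous_on (cball w \<rho>) F"
    unfolding F_def by (intro continuous_intros continuous_on_subset[OF cont]) auto
  then obtain p where p: "p \<in> cball w \<rho>" "\<And>y. y \<in> cball w \<rho> \<Longrightarrow> F p \<le> F y"
    using continuous_attains_inf[of "cball w \<rho>" F] \<rho>(1) by auto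
  have min: "F p \<le> F y" for y
  proof (cases "y \<in> cball w \<rho>")
    case False
    \<comment> \<open>Beyond distance \<open>\<rho>\<close> the quadratic term alone exceeds \<open>F w = \<psi> w\<close>.\<close>
    then have "\<rho>\<^sup>2 \<le> (norm (w - y))\<^sup>2"
      using \<rho>(1) by (intro power_mono) (auto simp: dist_norm)
    then have "F w \<le> F y" using \<rho>(2) nonneg[of y] by (simp add: F_def)
    moreover have "F p \<le> F w" using p(2) \<rho>(1) by simp
    ultimately show ?thesis by simp
  qed (use p in blast)
  have "F (arg_min F (\<lambda>_. True)) \<le> F \<xi>"
    by (rule arg_minI[where x = p]) (use min in \<open>auto simp: not_less\<close>)
  then show ?thesis by (simp add: F_def prox_def)
qed

lemma prox_optimality:
  fixes \<psi> :: "'a::euclidean_space \<Rightarrow> real"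
  assumes nonneg: "\<And>u. \<psi> u \<ge> 0" and diff: "\<And>u. GDERIV \<psi> u :> D u"
  shows "D (prox \<psi> w) = w - prox \<psi> w"
proof -
  define p where "p = prox \<psi> w"
  have cont: "continuous_on UNIV \<psi>"
    using diff unfolding gderiv_def
    by (meson has_derivative_continuous continuous_at_imp_continuous_on)
  define F where "F = (\<lambda>\<xi>. \<psi> \<xi> + 1 / 2 * ((w - \<xi>) \<bullet> (w - \<xi>)))"
  have "(F has_derivative (\<lambda>v. v \<bullet> D p + 1/2 * ((w - p) \<bullet> (- v) + (- v) \<bullet> (w - p)))) (at p)"
    unfolding F_def using diff[of p, unfolded gderiv_def]
    by (auto intro!: derivative_eq_intros)
  moreover have "F p \<le> F \<xi>" for \<xi>
    using prox_minimizes[OF nonneg cont, of w \<xi>]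
    by (simp add: F_def p_def power2_norm_eq_inner)
  ultimately have "(\<lambda>v. v \<bullet> D p + 1/2 * ((w - p) \<bullet> (- v) + (- v) \<bullet> (w - p))) = (\<lambda>v. 0)"
    by (intro has_derivative_local_min) auto
  from fun_cong[OF this, of "D p - (w - p)"]
  have "(D p - (w - p)) \<bullet> (D p - (w - p)) = 0"
    by (simp add: inner_simps inner_commute field_simps)
  then show ?thesis by (simp add: p_def)
qed

section \<open>Descent sequences under the Kurdyka--Lojasiewicz inequality\<close>

text \<open>Identifies the limit of the energy with its value at a cluster point of the iterates.\<close>

lemma decseq_limit_from_subseq:
  fixes s :: "nat \<Rightarrow> real"
  assumes dec: "decseq s" and r: "strict_mono r" and lim: "(s \<circ> r) \<longlonglongrightarrow> l"
  shows "s \<longlonglongrightarrow> l" and "l \<le> s n"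
proof -
  have ge: "l \<le> s n" for n
  proof -
    have "l \<le> (s \<circ> r) n"
      using lim by (rule decseq_ge[rotated]) (use dec r in \<open>auto simp: decseq_def strict_mono_leD\<close>)
    also have "\<dots> \<le> s n" using dec seq_suble[OF r, of n] by (simp add: decseq_def)
    finally show ?thesis .
  qed
  then show "l \<le> s n" .
  obtain l' where l': "s \<longlonglongrightarrow> l'" using decseq_convergent[OF dec, of l] ge by metis
  then show "s \<longlonglongrightarrow> l" using LIMSEQ_subseq_LIMSEQ[OF l' r] LIMSEQ_unique lim by blast
qed

text \<open>A concave desingularising function lies below its tangent at \<open>s\<close>. This converts the decrease
  \<open>s - t\<close> of the energy into a decrease of \<open>\<theta>\<close>, in which the factor \<open>deriv \<theta> s\<close> can be compared
  with the slope of the energy.\<close>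

lemma concave_tangent:
  fixes \<theta> :: "real \<Rightarrow> real"
  assumes "concave_on {0..<\<eta>} \<theta>" "\<theta> C1_differentiable_on {0<..<\<eta>}"
    and s: "0 < s" "s < \<eta>" and t: "0 \<le> t" "t \<le> s"
  shows "deriv \<theta> s * (s - t) \<le> \<theta> s - \<theta> t"
proof -
  have "\<theta> differentiable (at s)"
    using assms(2) s C1_differentiable_on_eq by (metis greaterThanLessThan_iff)
  then have "(\<theta> has_real_derivative deriv \<theta> s) (at s)"
    by (simp add: DERIV_deriv_iff_real_differentiable)
  then have "((\<lambda>x. - \<theta> x) has_real_derivative - deriv \<theta> s) (at s within {0..<\<eta>})"
    by (rule DERIV_minus[OF has_field_derivative_at_within])
  moreover have "convex_on {0..<\<eta>} (\<lambda>x. - \<theta> x)"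
    using assms(1) by (simp add: concave_on_def)
  moreover have "s \<in> interior {0..<\<eta>}" using s by simp
  ultimately have "- \<theta> t - - \<theta> s \<ge> - deriv \<theta> s * (t - s)"
    using s t by (intro convex_on_imp_above_tangent[of "{0..<\<eta>}"]) auto
  then show ?thesis by (simp add: algebra_simps)
qed

lemma summable_if_telescoping_bound:
  fixes a W :: "nat \<Rightarrow> real"
  assumes a: "\<And>n. a n \<ge> 0" and W: "\<And>n. n \<ge> m \<Longrightarrow> W n \<ge> 0"
    and step: "\<And>n. n \<ge> m \<Longrightarrow> a n \<le> W n - W (Suc n)"
  shows "summable a"
proof -
  have partial: "(\<Sum>k<n. a (k + m)) \<le> W m - W (n + m)" for n
  proof (induction n)
    case (Suc n)
    then show ?case using step[of "n + m"] by simp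
  qed simp
  have "(\<Sum>k\<le>n. a (k + m)) \<le> W m" for n
    using partial[of "Suc n"] W[of "Suc n + m"] by (simp add: lessThan_Suc_atMost)
  then have "summable (\<lambda>k. a (k + m))"
    using a by (intro bounded_imp_summable[where B = "W m"])
  then show ?thesis by (rule summable_iff_shift[THEN iffD1])
qed

lemma sufficient_decrease_tendsto_0:
  fixes a s :: "nat \<Rightarrow> real"
  assumes a: "\<And>n. a n \<ge> 0" and c: "c > 0" and s: "s \<longlonglongrightarrow> l"
    and decrease: "\<And>n. c * (a (Suc n))\<^sup>2 \<le> s n - s (Suc n)"
  shows "a \<longlonglongrightarrow> 0"
proof -
  have "(\<lambda>n. (s n - s (Suc n)) / c) \<longlonglongrightarrow> (l - l) / c"
    using c by (intro tendsto_intros s LIMSEQ_Suc) auto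
  then have lim: "(\<lambda>n. (s n - s (Suc n)) / c) \<longlonglongrightarrow> 0" by simp
  have "(a (Suc n))\<^sup>2 \<le> (s n - s (Suc n)) / c" for n
    using decrease[of n] c by (simp add: pos_le_divide_eq mult.commute)
  then have "(\<lambda>n. (a (Suc n))\<^sup>2) \<longlonglongrightarrow> 0"
    by (intro tendsto_sandwich[OF _ _ tendsto_const lim]) auto
  then have "(\<lambda>n. sqrt ((a (Suc n))\<^sup>2)) \<longlonglongrightarrow> sqrt 0" by (rule tendsto_real_sqrt)
  then have "(\<lambda>n. a (Suc n)) \<longlonglongrightarrow> 0" using a by simp
  then show ?thesis by (rule LIMSEQ_imp_Suc)
qed

text \<open>The arithmetic of one step. Here \<open>a\<close>, \<open>a'\<close> are two consecutive step lengths, \<open>t\<close> is the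
  derivative of the desingularising function at the current energy gap, \<open>g\<close> is the norm of the
  gradient and \<open>\<Delta>\<close> the decrease of the desingularising function. Eliminating \<open>t\<close> and \<open>g\<close> from \<open>kl\<close>, \<open>g\<close> and
  \<open>\<Delta>\<close> gives \<open>a'\<^sup>2 \<le> (C / c) \<Delta> (a + a')\<close>. The inequality of arithmetic and geometric means
  linearises this, with weights for which the coefficient of \<open>a'\<close> on the left exceeds that of \<open>a\<close> on
  the right. That gap is what makes the estimate summable.\<close>

lemma KL_one_step:
  fixes a a' A \<Delta> g t c C :: real
  assumes pos: "c > 0" "C > 0" "a \<ge> 0" "a' \<ge> 0" "t > 0"
    and kl: "t * g \<ge> 1" and g: "g \<le> C * (a + a')" and \<Delta>: "t * (c * a'\<^sup>2) \<le> \<Delta>"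
  shows "3 * a' \<le> a + 4 * (C / c) * \<Delta>"
proof -
  define A where "A = a + a'"
  have \<Delta>0: "\<Delta> \<ge> 0" using \<Delta> pos by (smt (verit) mult_nonneg_nonneg zero_le_power2)
  have "t * g \<le> t * (C * A)" using g pos by (intro mult_left_mono) (auto simp: A_def)
  with kl have A: "1 \<le> t * (C * A)" by linarith
  have A0: "A \<ge> 0" using pos by (simp add: A_def)
  have "c * a'\<^sup>2 * 1 \<le> c * a'\<^sup>2 * (t * (C * A))" using A pos by (intro mult_left_mono) auto
  also have "\<dots> = t * (c * a'\<^sup>2) * (C * A)" by simp
  also have "\<dots> \<le> \<Delta> * (C * A)" using \<Delta> pos A0 by (intro mult_right_mono) auto
  finally have "a'\<^sup>2 \<le> A * ((C / c) * \<Delta>)" using pos by (simp add: field_simps)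
  \<comment> \<open>The arithmetic-geometric mean inequality for \<open>A\<close> and \<open>4 * E\<close>.\<close>
  moreover define E where "E = (C / c) * \<Delta>"
  ultimately have "a'\<^sup>2 \<le> A * E" by metis
  then have "(4 * a')\<^sup>2 \<le> 16 * (A * E)"
    by (simp add: power_mult_distrib)
  also have "\<dots> \<le> (A + 4 * E)\<^sup>2"
    using zero_le_power2[of "A - 4 * E"] by (simp add: power2_eq_square algebra_simps)
  finally have "(4 * a')\<^sup>2 \<le> (A + 4 * ((C / c) * \<Delta>))\<^sup>2" by (simp add: E_def)
  then have "4 * a' \<le> A + 4 * ((C / c) * \<Delta>)"
    by (rule power2_le_imp_le) (use A0 \<Delta>0 pos in auto)
  then show ?thesis by (simp add: A_def algebra_simps)
qed

text \<open>
  Let \<open>\<theta>\<close> be a desingularising function of \<open>G\<close> at \<open>zbar\<close>, and \<open>s\<^sub>n\<close> the energy gap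
  \<open>G(z\<^sub>n) - G(zbar)\<close>, which decreases to zero. As long as \<open>z\<^sub>n\<close> stays close to \<open>zbar\<close>,
  \<open>KL_one_step\<close> says that the Lyapunov function \<open>W\<^sub>n = 2 a\<^sub>n + 4 K \<theta>(s\<^sub>n)\<close> decreases by at least
  \<open>a\<^sub>n + a\<^sub>n\<^sub>+\<^sub>1\<close>, which dominates the distance travelled. So, as long as the sequence has not left the
  neighbourhood, the total distance travelled since time \<open>m\<close> is at most \<open>b W\<^sub>m\<close>. Since \<open>W\<^sub>n\<close> tends to
  zero, some \<open>m\<close> with \<open>z\<^sub>m\<close> close to \<open>zbar\<close> has \<open>b W\<^sub>m\<close> too small for the sequence ever to escape.
  It is trapped, and the telescoping bound gives summability.

  The step length \<open>a\<^sub>n\<close> is a parameter separate from \<open>dist (z\<^sub>n) (z\<^sub>n\<^sub>+\<^sub>1)\<close> because an inertial method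
  controls the decrease by one velocity but the displacement of \<open>z\<close>, and the slope, by two consecutive ones.
\<close>

lemma KL_descent_summable:
  fixes G :: "'b::euclidean_space \<Rightarrow> real" and z :: "nat \<Rightarrow> 'b" and a :: "nat \<Rightarrow> real"
  assumes KL: "KL_property G"
    and pos: "b > 0" "c > 0" "C > 0" and a_nonneg: "\<And>n. a n \<ge> 0"
    and decrease: "\<And>n. c * (a (Suc n))\<^sup>2 \<le> G (z n) - G (z (Suc n))"
    and steps: "\<And>n. dist (z n) (z (Suc n)) \<le> b * (a n + a (Suc n))"
    and slope: "\<forall>\<^sub>F n in sequentially. norm (grad G (z n)) \<le> C * (a n + a (Suc n))"
    and r: "strict_mono r" and cluster: "(z \<circ> r) \<longlonglongrightarrow> zbar" and crit: "grad G zbar = 0"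
  shows "summable a"
proof -
  define s where "s = (\<lambda>n. G (z n) - G zbar)"
  have s_step: "c * (a (Suc n))\<^sup>2 \<le> s n - s (Suc n)" for n
    using decrease[of n] by (simp add: s_def)
  have s_le: "s (Suc n) \<le> s n" for n
    using s_step[of n] pos by (smt (verit) mult_nonneg_nonneg zero_le_power2)
  have s_dec: "decseq s" using s_le by (simp add: decseq_Suc_iff)
  have "isCont G zbar"
    using KL unfolding KL_property_def by (simp add: differentiable_imp_continuous_within)
  then have "(\<lambda>n. G ((z \<circ> r) n)) \<longlonglongrightarrow> G zbar" using cluster by (rule isCont_tendsto_compose)
  then have "(s \<circ> r) \<longlonglongrightarrow> 0"
    unfolding s_def o_def using tendsto_diff[OF _ tendsto_const[of "G zbar"]] by fastforce
  from decseq_limit_from_subseq[OF s_dec r this]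
  have s_lim: "s \<longlonglongrightarrow> 0" and s_nonneg: "\<And>n. s n \<ge> 0" by auto
  have a_lim: "a \<longlonglongrightarrow> 0"
    using sufficient_decrease_tendsto_0[OF a_nonneg pos(2) s_lim s_step] .
  show ?thesis
  proof (cases "\<exists>n. s n = 0")
    \<comment> \<open>The inequality says nothing where the gap vanishes, but then the sequence has stopped.\<close>
    case True
    then obtain n where n: "s n = 0" ..
    have "s k = 0" if "k \<ge> n" for k
      using s_nonneg[of k] s_dec that n by (metis antisym decseq_def)
    then have "a (Suc k) = 0" if "k \<ge> n" for k
      using s_step[of k] that pos
      by (smt (verit) le_SucI mult_pos_pos zero_less_power2)
    then have "a k = 0" if "k \<ge> Suc n" for k using that by (metis Suc_le_D Suc_le_mono)
    then have "\<forall>\<^sub>F k in sequentially. a k = 0"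
      unfolding eventually_sequentially by blast
    then show ?thesis using summable_cong[of a "\<lambda>_. 0"] by simp
  next
    case False
    then have s_pos: "s n > 0" for n using s_nonneg[of n] by (metis less_eq_real_def)
    obtain \<eta> U \<theta> where \<eta>: "\<eta> > 0" and U: "zbar \<in> interior U"
      and \<theta>_nonneg: "\<theta> ` {0..<\<eta>} \<subseteq> {0..}" and \<theta>_cont: "continuous_on {0..<\<eta>} \<theta>"
      and \<theta>_conc: "concave_on {0..<\<eta>} \<theta>" and \<theta>0: "\<theta> 0 = 0"
      and \<theta>_C1: "\<theta> C1_differentiable_on {0<..<\<eta>}"
      and \<theta>_pos: "\<And>s. s \<in> {0<..<\<eta>} \<Longrightarrow> deriv \<theta> s > 0"
      and kl: "\<And>y. y \<in> U \<Longrightarrow> G zbar < G y \<Longrightarrow> G y < G zbar + \<eta> \<Longrightarrow>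
                deriv \<theta> (G y - G zbar) * norm (grad G y) \<ge> 1"
      using KL crit unfolding KL_property_def by metis
    obtain \<rho> where \<rho>: "\<rho> > 0" "ball zbar \<rho> \<subseteq> U" using U by (meson mem_interior)
    have "\<forall>\<^sub>F n in sequentially. s n < \<eta>"
      using s_lim \<eta> by (rule order_tendstoD)
    from eventually_conj[OF this slope]
    obtain N where N: "\<And>n. n \<ge> N \<Longrightarrow> s n < \<eta>"
      "\<And>n. n \<ge> N \<Longrightarrow> norm (grad G (z n)) \<le> C * (a n + a (Suc n))"
      unfolding eventually_sequentially by auto
    have \<theta>s_nonneg: "\<theta> (s n) \<ge> 0" if "n \<ge> N" for n
      using \<theta>_nonneg N(1)[OF that] s_nonneg[of n] by (force simp: image_subset_iff)
    define K where "K = C / c"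
    have K: "K > 0" using pos by (simp add: K_def)
    define W where "W = (\<lambda>n. 2 * a n + 4 * K * \<theta> (s n))"
    have W_nonneg: "W n \<ge> 0" if "n \<ge> N" for n
      using K a_nonneg[of n] \<theta>s_nonneg[OF that] by (simp add: W_def)
    have W_step: "a n + a (Suc n) \<le> W n - W (Suc n)" if n: "n \<ge> N" and "z n \<in> ball zbar \<rho>" for n
    proof -
      have sn: "0 < s n" "s n < \<eta>" using s_pos N(1)[OF n] by auto
      have t: "deriv \<theta> (s n) > 0" using \<theta>_pos sn by simp
      have "deriv \<theta> (s n) * norm (grad G (z n)) \<ge> 1"
        using kl[of "z n"] sn that \<rho> by (auto simp: s_def)
      moreover have "deriv \<theta> (s n) * (c * (a (Suc n))\<^sup>2) \<le> \<theta> (s n) - \<theta> (s (Suc n))"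
      proof -
        have "deriv \<theta> (s n) * (c * (a (Suc n))\<^sup>2) \<le> deriv \<theta> (s n) * (s n - s (Suc n))"
          using t s_step by (intro mult_left_mono) auto
        also have "\<dots> \<le> \<theta> (s n) - \<theta> (s (Suc n))"
          using concave_tangent[OF \<theta>_conc \<theta>_C1 sn s_nonneg s_le] .
        finally show ?thesis .
      qed
      ultimately have "3 * a (Suc n) \<le> a n + 4 * K * (\<theta> (s n) - \<theta> (s (Suc n)))"
        unfolding K_def using KL_one_step pos a_nonneg t N(2)[OF n] by blast
      then show ?thesis by (simp add: W_def algebra_simps)
    qed
    have "(\<lambda>n. \<theta> (s n)) \<longlonglongrightarrow> \<theta> 0"
      using \<theta>_cont s_lim
      by (rule continuous_on_tendsto_compose)
         (use \<eta> N(1) s_nonneg in \<open>auto simp: eventually_sequentially\<close>)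
    then have "(\<lambda>n. W n) \<longlonglongrightarrow> 2 * 0 + 4 * K * 0"
      unfolding W_def \<theta>0 using a_lim by (intro tendsto_intros)
    then have "\<forall>\<^sub>F n in sequentially. W n < \<rho> / (2 * b)"
      using \<rho> pos by (intro order_tendstoD) auto
    then obtain M where M: "\<And>n. n \<ge> M \<Longrightarrow> W n < \<rho> / (2 * b)"
      unfolding eventually_sequentially by blast
    \<comment> \<open>Half of the radius is left for the initial distance to \<open>zbar\<close>, half for the distance travelled.\<close>
    have "\<forall>\<^sub>F n in sequentially. dist ((z \<circ> r) n) zbar < \<rho> / 2"
      using \<rho>(1) by (intro tendstoD[OF cluster]) simp
    then obtain k0 where k0: "\<And>k. k \<ge> k0 \<Longrightarrow> dist (z (r k)) zbar < \<rho> / 2"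
      unfolding eventually_sequentially by auto
    define m where "m = r (max k0 (max N M))"
    have m: "m \<ge> N" "m \<ge> M" "dist (z m) zbar < \<rho> / 2"
      using seq_suble[OF r, of "max k0 (max N M)"] k0 unfolding m_def by auto
    have trapped: "dist (z m) (z (m + k)) \<le> b * (W m - W (m + k)) \<and> z (m + k) \<in> ball zbar \<rho>" for k
    proof (induction k)
      case 0
      then show ?case using m \<rho> by (simp add: dist_commute)
    next
      case (Suc k)
      have "dist (z m) (z (m + Suc k)) \<le> dist (z m) (z (m + k)) + dist (z (m + k)) (z (m + Suc k))"
        by (rule dist_triangle)
      also have "\<dots> \<le> b * (W m - W (m + k)) + b * (a (m + k) + a (Suc (m + k)))"
        using Suc steps[of "m + k"] by (intro add_mono) auto
      also have "\<dots> \<le> b * (W m - W (m + k)) + b * (W (m + k) - W (Suc (m + k)))"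
        using Suc W_step[of "m + k"] m pos by (intro add_left_mono mult_left_mono) auto
      finally have d: "dist (z m) (z (m + Suc k)) \<le> b * (W m - W (m + Suc k))"
        by (simp add: algebra_simps)
      also have "\<dots> \<le> b * W m"
        using W_nonneg[of "m + Suc k"] m pos by (intro mult_left_mono) auto
      also have "\<dots> < \<rho> / 2"
        using M[OF m(2)] pos by (simp add: field_simps)
      finally have "dist (z m) (z (m + Suc k)) < \<rho> / 2" .
      moreover have "dist zbar (z (m + Suc k)) \<le> dist (z m) zbar + dist (z m) (z (m + Suc k))"
        by (metis dist_commute dist_triangle)
      ultimately have "z (m + Suc k) \<in> ball zbar \<rho>" using m(3) by simp
      with d show ?case by blast
    qed
    have "a n \<le> W n - W (Suc n)" if "n \<ge> m" for n
      using W_step[of n] trapped[of "n - m"] that m a_nonneg[of "Suc n"] by simp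
    then show ?thesis
      using a_nonneg W_nonneg m by (intro summable_if_telescoping_bound[of a m W]) auto
  qed
qed

section \<open>The inertial proximal algorithm\<close>

lemma grad_energy:
  fixes f :: "'a::euclidean_space \<Rightarrow> real"
  assumes "GDERIV f u :> grad f u"
  shows "grad (\<lambda>(u, v). f u + \<kappa> / 2 * (norm (u - v))\<^sup>2) (u, v)
       = (grad f u + \<kappa> *\<^sub>R (u - v), - (\<kappa> *\<^sub>R (u - v)))"
proof (rule grad_eqI)
  have 1: "((\<lambda>p. f (fst p)) has_derivative (\<lambda>p. fst p \<bullet> grad f u)) (at (u, v))"
    using assms has_derivative_compose[OF has_derivative_fst[OF has_derivative_ident], where x = "(u, v)" and g = f]
    unfolding gderiv_def by simp
  have "((\<lambda>p. f (fst p) + \<kappa> / 2 * ((fst p - snd p) \<bullet> (fst p - snd p))) has_derivative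
      (\<lambda>p. p \<bullet> (grad f u + \<kappa> *\<^sub>R (u - v), - (\<kappa> *\<^sub>R (u - v))))) (at (u, v))"
    by (rule derivative_eq_intros 1 refl)+
       (auto simp: fun_eq_iff inner_Pair inner_simps inner_commute algebra_simps)
  then show "GDERIV (\<lambda>(u, v). f u + \<kappa> / 2 * (norm (u - v))\<^sup>2) (u, v)
      :> (grad f u + \<kappa> *\<^sub>R (u - v), - (\<kappa> *\<^sub>R (u - v)))"
    by (simp add: gderiv_def case_prod_beta' power2_norm_eq_inner)
qed

lemma convergent_if_summable_norm_diff:
  fixes x :: "nat \<Rightarrow> 'a::banach"
  assumes "summable (\<lambda>n. norm (x (n + 1) - x n))"
  shows "convergent x"
proof -
  have "summable (\<lambda>n. x (Suc n) - x n)"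
    by (rule summable_norm_cancel) (use assms in simp)
  then have "convergent (\<lambda>n. x n - x 0)"
    by (simp add: summable_iff_convergent sum_lessThan_telescope)
  then show ?thesis by (simp add: convergent_diff_const_right_iff)
qed

theorem theorem8p2:
  fixes f \<phi> :: "'a::euclidean_space \<Rightarrow> real"
    and x :: "nat \<Rightarrow> 'a"
    and h \<gamma> \<epsilon> \<delta> R L :: real
  assumes f_C2: "C2_map f"
    and f_lip: "lipschitz_on_bounded_sets (grad f)"
    and f_bdd_below: "bdd_below (range f)"
    and phi_damping: "damping_potential \<phi>"
    and phi_diff: "\<forall>u. \<phi> differentiable (at u)"
    and h_pos: "h > 0"
    and x_bounded: "bounded (range x)"
    and x_rec: "\<forall>n. x (n + 2) = x (n + 1) +
        h *\<^sub>R prox (\<lambda>u. h * \<phi> u) ((1 / h) *\<^sub>R (x (n + 1) - x n) - h *\<^sub>R grad f (x (n + 1)))"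
    and H_KL: "KL_property (\<lambda>(u :: 'a, v :: 'a). f u + 1 / (2 * h\<^sup>2) * (norm (u - v))\<^sup>2)"
    and constants_pos: "\<gamma> > 0" "\<epsilon> > 0" "\<delta> > 0"
    and phi_lower: "\<forall>u. \<phi> u \<ge> \<gamma> * (norm u)\<^sup>2"
    and phi_grad: "\<forall>u. norm u \<le> \<epsilon> \<longrightarrow> norm (grad \<phi> u) \<le> \<delta> * norm u"
    and R_def: "R = (SUP n. norm (x n))"
    and L_def: "L = lipschitz_constant (grad f) (cball 0 R)"
    and h_upper: "L \<noteq> 0 \<longrightarrow> h < 2 * \<gamma> / L"
  shows "(\<exists>x_inf. x \<longlonglongrightarrow> x_inf \<and> grad f x_inf = 0) \<and>
         summable (\<lambda>n. norm (x (n + 1) - x n))"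
proof -
  obtain f' where f': "\<And>u. (f has_derivative blinfun_apply (f' u)) (at u)"
    using f_C2 unfolding C2_map_def by blast
  have f_grad: "GDERIV f u :> grad f u" for u
    using f' by (intro differentiable_imp_GDERIV_grad) (auto simp: differentiable_def)
  have gradf_cont: "isCont (grad f) u" for u
    using f_lip by (rule lipschitz_on_bounded_sets_isCont)
  have phi: "\<And>u. \<phi> u \<ge> 0" "convex_on UNIV \<phi>" "\<phi> 0 = 0"
    using phi_damping by (auto simp: damping_potential_def)
  have phi_GDERIV: "GDERIV \<phi> u :> grad \<phi> u" for u
    using phi_diff by (intro differentiable_imp_GDERIV_grad) auto

  have x_R: "norm (x n) \<le> R" for n
    unfolding R_def
    by (rule cSUP_upper) (use x_bounded in \<open>auto simp: bounded_iff bdd_above_def\<close>)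
  have L_lip: "L-lipschitz_on (cball 0 R) (grad f)"
    unfolding L_def using f_lip
    by (intro lipschitz_constant_lipschitz_on) (auto simp: lipschitz_on_bounded_sets_def)
  have L_nonneg: "L \<ge> 0" using L_lip by (rule lipschitz_on_nonneg)
  \<comment> \<open>For \<open>L = 0\<close> this holds because \<open>\<gamma>\<close> is positive.\<close>
  have hL: "h * L < 2 * \<gamma>"
    using h_upper L_nonneg constants_pos by (cases "L = 0") (auto simp: pos_less_divide_eq)

  define v where "v = (\<lambda>n. (1 / h) *\<^sub>R (x (Suc n) - x n))"
  have x_Suc: "x (Suc n) - x n = h *\<^sub>R v n" for n
    using h_pos by (simp add: v_def)
  have fermat: "h *\<^sub>R grad \<phi> (v (Suc n)) = v n - v (Suc n) - h *\<^sub>R grad f (x (Suc n))" for n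
  proof -
    define w where "w = v n - h *\<^sub>R grad f (x (Suc n))"
    have "x (Suc (Suc n)) - x (Suc n) = h *\<^sub>R prox (\<lambda>u. h * \<phi> u) w"
      using x_rec[rule_format, of n] by (simp add: w_def v_def)
    then have v: "v (Suc n) = prox (\<lambda>u. h * \<phi> u) w"
      using h_pos by (simp add: v_def)
    have "GDERIV (\<lambda>u. h * \<phi> u) u :> h *\<^sub>R grad \<phi> u" for u
      using phi_GDERIV[of u] unfolding gderiv_def
      by (auto intro!: derivative_eq_intros simp: inner_scaleR_right)
    then have "h *\<^sub>R grad \<phi> (v (Suc n)) = w - v (Suc n)"
      unfolding v using prox_optimality[of "\<lambda>u. h * \<phi> u" "\<lambda>u. h *\<^sub>R grad \<phi> u" w] phi(1) h_pos by simp
    then show ?thesis by (simp add: w_def)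
  qed

  define H where "H = (\<lambda>(u :: 'a, v :: 'a). f u + 1 / (2 * h\<^sup>2) * (norm (u - v))\<^sup>2)"
  define z where "z = (\<lambda>n. (x (Suc n), x n))"
  define a where "a = (\<lambda>n. norm (v n))"
  define c where "c = h * (\<gamma> - h * L / 2)"
  have c_pos: "c > 0" using hL h_pos by (simp add: c_def)
  have H_z: "H (z n) = f (x (Suc n)) + 1 / 2 * (a n)\<^sup>2" for n
    using h_pos by (simp add: H_def z_def a_def x_Suc power_mult_distrib field_simps)

  \<comment> \<open>Energy dissipation: Fermat's rule paired with the new velocity \<open>p\<close>.\<close>
  have decrease: "c * (a (Suc n))\<^sup>2 \<le> H (z n) - H (z (Suc n))" for n
  proof -
    define p where "p = v (Suc n)"
    have "grad \<phi> p \<bullet> p \<ge> \<phi> p"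
      using convex_gradient_inequality[OF phi(2) phi_GDERIV, of p 0] phi(3) by simp
    then have "h * (\<gamma> * (norm p)\<^sup>2) \<le> h * (grad \<phi> p \<bullet> p)"
      using phi_lower[rule_format, of p] h_pos by (intro mult_left_mono) auto
    also have "\<dots> = (v n - p - h *\<^sub>R grad f (x (Suc n))) \<bullet> p"
      using arg_cong[OF fermat[of n], of "\<lambda>y. y \<bullet> p"] by (simp add: p_def)
    finally have "h * (\<gamma> * (norm p)\<^sup>2) \<le> (v n - p) \<bullet> p - grad f (x (Suc n)) \<bullet> (h *\<^sub>R p)"
      by (simp add: inner_diff_left)
    moreover have "(v n - p) \<bullet> p \<le> 1 / 2 * (norm (v n))\<^sup>2 - 1 / 2 * (norm p)\<^sup>2"
      using inner_ge_zero[of "v n - p"]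
      by (simp add: power2_norm_eq_inner inner_simps inner_commute)
    moreover have "f (x (Suc (Suc n))) \<le> f (x (Suc n)) + grad f (x (Suc n)) \<bullet> (h *\<^sub>R p) + L / 2 * (h * norm p)\<^sup>2"
      using descent_lemma[OF f_grad L_lip, of "x (Suc n)" "x (Suc (Suc n))"] x_R h_pos
      by (simp add: x_Suc p_def)
    ultimately show ?thesis
      unfolding H_z by (simp add: a_def c_def p_def[symmetric] power_mult_distrib power2_eq_square algebra_simps)
  qed

  have H_KL': "KL_property H" using H_KL by (simp add: H_def)
  have a_lim: "a \<longlonglongrightarrow> 0"
  proof -
    obtain B where B: "\<And>u. B \<le> f u" using f_bdd_below by (auto simp: bdd_below_def)
    have "H (z (Suc n)) \<le> H (z n)" for n
      using decrease[of n] c_pos by (smt (verit) mult_nonneg_nonneg zero_le_power2)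
    then have dec: "decseq (\<lambda>n. H (z n))" by (simp add: decseq_Suc_iff)
    have "B \<le> H (z n)" for n using B[of "x (Suc n)"] by (simp add: H_z add_increasing2)
    then obtain l where l: "(\<lambda>n. H (z n)) \<longlonglongrightarrow> l" using decseq_convergent[OF dec] by metis
    have "a n \<ge> 0" for n by (simp add: a_def)
    from sufficient_decrease_tendsto_0[OF this c_pos l decrease] show ?thesis .
  qed

  \<comment> \<open>Once the velocities are below \<open>\<epsilon>\<close>, the damping force is controlled by the velocity, so
    Fermat's rule bounds \<open>\<nabla>f\<close> by two consecutive velocities.\<close>
  define C where "C = 1 / h + 1 + \<delta>"
  have ev_small: "\<forall>\<^sub>F n in sequentially. a (Suc n) < \<epsilon>"
    using LIMSEQ_Suc[OF a_lim] constants_pos by (intro order_tendstoD) auto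
  have gradf_le: "\<forall>\<^sub>F n in sequentially. norm (grad f (x (Suc n))) \<le> C * (a n + a (Suc n))"
    using ev_small
  proof eventually_elim
    case (elim n)
    have "(1 / h) *\<^sub>R (h *\<^sub>R grad f (x (Suc n)))
        = (1 / h) *\<^sub>R ((v n - v (Suc n)) - h *\<^sub>R grad \<phi> (v (Suc n)))"
      using fermat[of n] by simp
    then have "grad f (x (Suc n)) = (1 / h) *\<^sub>R (v n - v (Suc n)) - grad \<phi> (v (Suc n))"
      using h_pos by (simp add: scaleR_diff_right)
    then have "norm (grad f (x (Suc n))) \<le> norm ((1 / h) *\<^sub>R (v n - v (Suc n))) + norm (grad \<phi> (v (Suc n)))"
      by (metis norm_triangle_ineq4)
    also have "\<dots> \<le> (1 / h) * (a n + a (Suc n)) + \<delta> * a (Suc n)"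
      using h_pos elim phi_grad[rule_format, of "v (Suc n)"] norm_triangle_ineq4[of "v n" "v (Suc n)"]
      by (intro add_mono) (auto simp: a_def divide_right_mono)
    also have "\<dots> \<le> C * (a n + a (Suc n))"
      using constants_pos by (simp add: C_def a_def algebra_simps)
    finally show ?case .
  qed
  have H_eq: "H = (\<lambda>(u, v). f u + (1 / h\<^sup>2) / 2 * (norm (u - v))\<^sup>2)"
    by (simp add: H_def mult.commute)
  have gradH: "grad H (u, w) = (grad f u + (1 / h\<^sup>2) *\<^sub>R (u - w), - ((1 / h\<^sup>2) *\<^sub>R (u - w)))" for u w
    unfolding H_eq by (rule grad_energy[OF f_grad])
  have slope: "\<forall>\<^sub>F n in sequentially. norm (grad H (z n)) \<le> (C + 2 / h) * (a n + a (Suc n))"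
    using gradf_le
  proof eventually_elim
    case (elim n)
    have "grad H (z n) = (grad f (x (Suc n)) + (1 / h) *\<^sub>R v n, - ((1 / h) *\<^sub>R v n))"
      using h_pos by (simp add: z_def gradH x_Suc power2_eq_square)
    then have "norm (grad H (z n)) \<le> norm (grad f (x (Suc n)) + (1 / h) *\<^sub>R v n) + norm ((1 / h) *\<^sub>R v n)"
      using norm_Pair_le[of "grad f (x (Suc n)) + (1 / h) *\<^sub>R v n" "- ((1 / h) *\<^sub>R v n)"]
      by (metis norm_minus_cancel)
    also have "\<dots> \<le> norm (grad f (x (Suc n))) + norm ((1 / h) *\<^sub>R v n) + norm ((1 / h) *\<^sub>R v n)"
      by (intro add_right_mono norm_triangle_ineq)
    also have "\<dots> \<le> C * (a n + a (Suc n)) + (2 / h) * a n"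
      using elim h_pos by (simp add: a_def)
    also have "\<dots> \<le> (C + 2 / h) * (a n + a (Suc n))"
      using h_pos by (simp add: a_def algebra_simps)
    finally show ?case .
  qed

  have steps: "dist (z n) (z (Suc n)) \<le> h * (a n + a (Suc n))" for n
  proof -
    have "dist (z n) (z (Suc n)) = norm (h *\<^sub>R v (Suc n), h *\<^sub>R v n)"
      by (simp add: z_def dist_Pair_Pair norm_Pair dist_norm norm_minus_commute flip: x_Suc)
    also have "\<dots> \<le> norm (h *\<^sub>R v (Suc n)) + norm (h *\<^sub>R v n)" by (rule norm_Pair_le)
    finally show ?thesis using h_pos by (simp add: a_def algebra_simps)
  qed

  have gradf_lim: "(\<lambda>n. grad f (x (Suc n))) \<longlonglongrightarrow> 0"
  proof (rule Lim_null_comparison[OF gradf_le])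
    have "(\<lambda>n. C * (a n + a (Suc n))) \<longlonglongrightarrow> C * (0 + 0)"
      using a_lim LIMSEQ_Suc[OF a_lim] by (intro tendsto_intros)
    then show "(\<lambda>n. C * (a n + a (Suc n))) \<longlonglongrightarrow> 0" by simp
  qed
  \<comment> \<open>A cluster point of \<open>x\<close> gives one of \<open>z\<close> on the diagonal, because the velocities vanish.\<close>
  obtain l r where r: "strict_mono r" and l: "(x \<circ> r) \<longlonglongrightarrow> l"
    using bounded_imp_convergent_subsequence[OF x_bounded] by blast
  have l_Suc: "(\<lambda>n. x (Suc (r n))) \<longlonglongrightarrow> l"
  proof -
    have "v \<longlonglongrightarrow> 0" using a_lim unfolding a_def by (rule tendsto_norm_zero_cancel)
    then have "(\<lambda>n. v (r n)) \<longlonglongrightarrow> 0"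
      using LIMSEQ_subseq_LIMSEQ[OF _ r] unfolding o_def by blast
    then have "(\<lambda>n. x (r n) + h *\<^sub>R v (r n)) \<longlonglongrightarrow> l + h *\<^sub>R 0"
      using l unfolding o_def by (intro tendsto_intros)
    then show ?thesis by (simp flip: x_Suc)
  qed
  have "grad f l = 0"
    using isCont_tendsto_compose[OF gradf_cont l_Suc] LIMSEQ_subseq_LIMSEQ[OF gradf_lim r]
    by (auto simp: o_def intro: LIMSEQ_unique)
  then have crit: "grad H (l, l) = 0" by (simp add: gradH zero_prod_def)
  have cluster: "(z \<circ> r) \<longlonglongrightarrow> (l, l)"
    using tendsto_Pair[OF l_Suc l] by (simp add: z_def o_def)
  have "C + 2 / h > 0" using h_pos constants_pos by (simp add: C_def add_pos_pos)
  then have "summable a"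
    using KL_descent_summable[OF H_KL' h_pos c_pos _ _ decrease steps slope r cluster crit]
    by (simp add: a_def)
  then have "summable (\<lambda>n. h * a n)" by (rule summable_mult)
  then have sum: "summable (\<lambda>n. norm (x (n + 1) - x n))"
    using h_pos by (simp add: a_def x_Suc)
  then obtain x_inf where x_inf: "x \<longlonglongrightarrow> x_inf"
    using convergent_if_summable_norm_diff unfolding convergent_def by blast
  have "grad f x_inf = 0"
    using LIMSEQ_unique[OF isCont_tendsto_compose[OF gradf_cont LIMSEQ_Suc[OF x_inf]] gradf_lim] .
  with x_inf sum show ?thesis by blast
qed

end
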